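(* Let $p$ be a prime, $D\ge 1$, $\mathbb{M}=\mathbb{Z}^D$ and $\mathcal{A}=\mathbb{Z}/p\mathbb{Z}$. Any locally free Markov random field on $\mathcal{A}^{\mathbb{M}}$ is harmonically mixing. That is: let $\mathbb{B}\subset\mathbb{M}$ be a finite subset with $-\mathbb{B}=\mathbb{B}$, and let $\mu$ be a Borel probability measure on $\mathcal{A}^{\mathbb{M}}$ which is a Markov random field with interaction range $\mathbb{B}$ and is locally free; then $\mu$ is harmonically mixing.
   Context: $\mathcal{A}$ is discrete and $\mathcal{A}^{\mathbb{M}}$ carries the product topology. For $\mathbb{U}\subset\mathbb{M}$ and $\mathbf{b}\in\mathcal{A}^{\mathbb{U}}$, $[\mathbf{b}]=\{\mathbf{c}\in\mathcal{A}^{\mathbb{M}} : \mathbf{c}_{\mathbb{U}}=\mathbf{b}\}$ is the corresponding cylinder set, and $\mu^{(\mathbf{b})}$ is the conditional probability measure of $\mu$ in $[\mathbf{b}]$, i.e. $\mu^{(\mathbf{b})}[\mathfrak{X}]=\mu(\mathfrak{X}\cap[\mathbf{b}])/\mu[\mathbf{b}]$; $\mu^{(\mathbf{b})}_{\mathbb{I}}$ is its marginal on $\mathcal{A}^{\mathbb{I}}$ for $\mathbb{I}\subset\mathbb{M}$. For $\mathbb{U}\subset\mathbb{M}$ put $\mathrm{cl}(\mathbb{U})=\{u+b : u\in\mathbb{U},\, b\in\mathbb{B}\}$ and $\partial\mathbb{U}=\mathrm{cl}(\mathbb{U})\setminus\mathbb{U}$. Markov random field with interaction range $\mathbb{B}$: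 for every $\mathbb{U}\subset\mathbb{M}$, with $\mathbb{V}=\partial\mathbb{U}$ and $\mathbb{W}=\mathbb{M}\setminus\mathrm{cl}(\mathbb{U})$, and every $\mathbf{b}\in\mathcal{A}^{\mathbb{V}}$, the conditional measure $\mu^{(\mathbf{b})}$ is a product of $\mu^{(\mathbf{b})}_{\mathbb{U}}$ and $\mu^{(\mathbf{b})}_{\mathbb{W}}$, i.e. $\mu^{(\mathbf{b})}(\mathfrak{U}\cap\mathfrak{W})=\mu^{(\mathbf{b})}_{\mathbb{U}}(\mathfrak{U})\,\mu^{(\mathbf{b})}_{\mathbb{W}}(\mathfrak{W})$ for all $\mathfrak{U}\subset\mathcal{A}^{\mathbb{U}}$ and $\mathfrak{W}\subset\mathcal{A}^{\mathbb{W}}$. Locally free: with $\mathbb{S}=\mathbb{B}\setminus\{0\}$, for every $\mathbf{b}\in\mathcal{A}^{\mathbb{S}}$, the conditional probability measure $\mu^{(\mathbf{b})}_0$ on the coordinate at $0$ has support with at least $2$ elements. A character of $\mathcal{A}^{\mathbb{M}}$ is a continuous homomorphism $\boldsymbol\chi:\mathcal{A}^{\mathbb{M}}\to\{z\in\mathbb{C}:|z|=1\}$. Each has the form $\boldsymbol\chi(\mathbf{a})=\prod_{k\in\mathbb{K}}\chi_k(a_k)$ with $\mathbb{K}\subset\mathbb{M}$ finite and each $\chi_k$ a nontrivial character of $\mathcal{A}$; its rank is $\mathrm{rank}(\boldsymbol\chi)=\#\mathbb{K}$. Write $\langle\boldsymbol\chi,\mu\rangle=\int\boldsymbol\chi\,d\mu$.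 Harmonically mixing: for every $\epsilon>0$ there is $R\in\mathbb{N}$ such that every character $\boldsymbol\chi$ with $\mathrm{rank}(\boldsymbol\chi)>R$ satisfies $|\langle\boldsymbol\chi,\mu\rangle|<\epsilon$.
   Formalization: The measure μ is additionally assumed shift-invariant (stationary); without this the claim fails, e.g. for B = {0} and the product measure that is uniform at site 0 and constantly 0 at every other site. *)

theory Defs
  imports
    "HOL-Probability.Probability"
    "HOL-Library.Function_Algebras"
    "Berlekamp_Zassenhaus.Finite_Field"
begin

text \<open>
  \<open>'p mod_ring\<close> is the ring of integers modulo \<open>CARD('p)\<close>; it gets the discrete topology.
  A configuration is a function \<open>'m \<Rightarrow> 'a\<close> from the lattice to the alphabet. The topology on
  the function type is the product topology, \<open>borel\<close> is its Borel algebra, and the group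
  structure is pointwise.
\<close>

instantiation mod_ring :: (finite) discrete_topology
begin

definition open_mod_ring :: "'a mod_ring set \<Rightarrow> bool" where
  "open_mod_ring _ = True"

instance by standard (auto simp: open_mod_ring_def)

end

instance mod_ring :: (finite) second_countable_topology
proof
  have "(open :: 'a mod_ring set \<Rightarrow> bool) = generate_topology UNIV"
    by (auto simp: fun_eq_iff open_mod_ring_def intro: generate_topology.Basis)
  moreover have "countable (UNIV :: 'a mod_ring set set)"
    by (simp add: countable_finite)
  ultimately show "\<exists>\<B> :: 'a mod_ring set set. countable \<B> \<and> open = generate_topology \<B>"
    by blast
qed

text \<open>The elements of \<open>\<A>\<^sup>U\<close> are the extensional functions \<open>b \<in> U \<rightarrow>\<^sub>E UNIV\<close>.\<close>

definition cylinder :: "'m set \<Rightarrow> ('m \<Rightarrow> 'a) \<Rightarrow> ('m \<Rightarrow> 'a) set" where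
  "cylinder U b = {c. restrict c U = b}"

text \<open>
  The measure \<open>X \<mapsto> \<mu> (X \<inter> [b]) / \<mu> [b]\<close>. It is meaningful only if \<open>\<mu> [b] > 0\<close>, and the
  definitions below use it only in that case.
\<close>

definition conditional ::
  "('m \<Rightarrow> 'a) measure \<Rightarrow> 'm set \<Rightarrow> ('m \<Rightarrow> 'a) \<Rightarrow> ('m \<Rightarrow> 'a) measure" where
  "conditional \<mu> U b = uniform_measure \<mu> (cylinder U b)"

definition marginal ::
  "('m \<Rightarrow> 'a::topological_space) measure \<Rightarrow> 'm set \<Rightarrow> ('m \<Rightarrow> 'a) measure" where
  "marginal \<mu> I = distr \<mu> (Pi\<^sub>M I (\<lambda>_. borel)) (\<lambda>c. restrict c I)"

definition nbhd :: "'m::plus set \<Rightarrow> 'm set \<Rightarrow> 'm set" where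
  "nbhd B U = {u + b | u b. u \<in> U \<and> b \<in> B}"

definition boundary :: "'m::plus set \<Rightarrow> 'm set \<Rightarrow> 'm set" where
  "boundary B U = nbhd B U - U"

text \<open>
  \<open>U\<close> may be infinite; then \<open>boundary B U\<close> may be infinite too, and only those cylinders over
  it that have positive mass impose a condition.
\<close>

definition markov_random_field ::
  "'m::plus set \<Rightarrow> ('m \<Rightarrow> 'a::topological_space) measure \<Rightarrow> bool" where
  "markov_random_field B \<mu> \<longleftrightarrow>
    (\<forall>U. let V = boundary B U; W = UNIV - nbhd B U in
      \<forall>b \<in> V \<rightarrow>\<^sub>E UNIV. measure \<mu> (cylinder V b) > 0 \<longrightarrow>
        (\<forall>X \<in> sets (Pi\<^sub>M U (\<lambda>_. borel)). \<forall>Y \<in> sets (Pi\<^sub>M W (\<lambda>_. borel)).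
          measure (conditional \<mu> V b) ({c. restrict c U \<in> X} \<inter> {c. restrict c W \<in> Y}) =
          measure (marginal (conditional \<mu> V b) U) X *
          measure (marginal (conditional \<mu> V b) W) Y))"

text \<open>The alphabet is finite and discrete, so a support is the set of points of positive mass.\<close>

definition locally_free ::
  "'m::{plus, zero} set \<Rightarrow> ('m \<Rightarrow> 'a::{finite, topological_space}) measure \<Rightarrow> bool" where
  "locally_free B \<mu> \<longleftrightarrow>
    (let S = B - {0} in
      \<forall>b \<in> S \<rightarrow>\<^sub>E UNIV. measure \<mu> (cylinder S b) > 0 \<longrightarrow>
        card {a. measure (distr (conditional \<mu> S b) borel (\<lambda>c. c 0)) {a} > 0} \<ge> 2)"

text \<open>
  Local freeness constrains the coordinate at \<open>0\<close> only; shift-invariance carries it to the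
  other coordinates. Without it, take \<open>B = {0}\<close> and the product measure whose coordinate at
  \<open>0\<close> is uniform and whose other coordinates are constantly \<open>0\<close>: this is a locally free
  Markov random field, but every character that does not involve the coordinate \<open>0\<close> has
  integral \<open>1\<close>.
\<close>

definition shift_invariant :: "('m::plus \<Rightarrow> 'a) measure \<Rightarrow> bool" where
  "shift_invariant \<mu> \<longleftrightarrow> (\<forall>v. distr \<mu> \<mu> (\<lambda>c m. c (m + v)) = \<mu>)"

text \<open>Used both for the alphabet and for the group of configurations.\<close>

definition character :: "('g::{topological_space, plus} \<Rightarrow> complex) \<Rightarrow> bool" where
  "character \<psi> \<longleftrightarrow>
    continuous_on UNIV \<psi> \<and> (\<forall>x. norm (\<psi> x) = 1) \<and> (\<forall>x y. \<psi> (x + y) = \<psi> x * \<psi> y)"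

definition char_rank :: "(('m \<Rightarrow> 'a::{topological_space, plus}) \<Rightarrow> complex) \<Rightarrow> nat" where
  "char_rank \<psi> = (THE r. \<exists>K \<xi>. finite K \<and> card K = r \<and>
    (\<forall>k\<in>K. character (\<xi> k) \<and> \<xi> k \<noteq> (\<lambda>_. 1)) \<and>
    (\<forall>a. \<psi> a = (\<Prod>k\<in>K. \<xi> k (a k))))"

definition harmonically_mixing ::
  "('m \<Rightarrow> 'a::{topological_space, plus}) measure \<Rightarrow> bool" where
  "harmonically_mixing \<mu> \<longleftrightarrow>
    (\<forall>\<epsilon>>0. \<exists>R. \<forall>\<psi>. character \<psi> \<and> char_rank \<psi> > R \<longrightarrow> norm (LINT c|\<mu>. \<psi> c) < \<epsilon>)"

end

theory Submission
  imports Defs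
begin

text \<open>
  A character of rank \<open>r\<close> is a product \<open>\<Prod>k\<in>K. \<xi> k (c k)\<close> of nontrivial characters of the
  alphabet over a set \<open>K\<close> of \<open>r\<close> sites (\<open>character_rank_factorization\<close>). The integral of such
  a product is small because, given its neighbours, each site still fluctuates, and sites that
  are not neighbours of each other fluctuate independently.

  In detail: the Markov property for \<open>U = {j}\<close> says that the value at \<open>j\<close>, given all other
  sites, depends only on the sites in \<open>j + (B - {0})\<close>. Under the integral one may therefore
  replace the factor \<open>\<xi> j (c j)\<close> by its conditional mean given these neighbours
  (\<open>integral_condition_site\<close>). By local freeness the conditional law at \<open>j\<close> charges two letters,
  and a nontrivial character of a cyclic group of prime order is injective, so the conditional
  mean is a proper convex combination of points of the unit circle and lies in the open unit
  disc. Up to translation, which shift-invariance absorbs, there are only finitely many boundary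
  patterns and finitely many characters of the alphabet; hence all these means are bounded by a
  single \<open>\<rho> < 1\<close> (\<open>locally_free_contraction\<close>).

  If \<open>J \<subseteq> K\<close> contains no two neighbours, the replacement can be done for all \<open>j \<in> J\<close> one after
  the other, since the conditional mean at one site does not involve the other sites of \<open>J\<close>.
  This bounds the integral by \<open>\<rho> ^ card J\<close> (\<open>integral_separated_bound\<close>). A maximal such \<open>J\<close>
  has at least \<open>card K / (card B + 1)\<close> elements (\<open>separated_subset\<close>), so the bound tends to
  \<open>0\<close> as the rank grows.
\<close>

section \<open>Characters\<close>

text \<open>
  The iterate \<open>((+) x ^^ n) 0\<close> is the \<open>n\<close>-fold sum of \<open>x\<close>. This form needs no unit element, so it
  applies to residues and to configurations alike.
\<close>

lemma character_funpow:
  fixes \<psi> :: "'g::{topological_space, comm_monoid_add} \<Rightarrow> complex"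
  assumes "character \<psi>"
  shows "\<psi> (((+) x ^^ n) 0) = \<psi> x ^ n"
proof (induction n)
  case 0
  have "\<psi> 0 * \<psi> 0 = \<psi> 0" "norm (\<psi> 0) = 1"
    using assms unfolding character_def by (metis add.right_neutral)+
  then show ?case by auto
next
  case (Suc n)
  then show ?case using assms by (simp add: character_def)
qed

lemma character_0:
  fixes \<psi> :: "'g::{topological_space, comm_monoid_add} \<Rightarrow> complex"
  assumes "character \<psi>"
  shows "\<psi> 0 = 1"
  using character_funpow[OF assms, of 0 0] by simp

lemma to_int_mod_ring_funpow:
  fixes x :: "'p::finite mod_ring"
  shows "to_int_mod_ring (((+) x ^^ n) 0) = (int n * to_int_mod_ring x) mod int CARD('p)"
proof (induction n)
  case 0
  then show ?case by simp
next
  case (Suc n)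
  have "to_int_mod_ring (((+) x ^^ Suc n) 0)
      = (to_int_mod_ring x + to_int_mod_ring (((+) x ^^ n) 0)) mod int CARD('p)"
    by (simp add: to_int_mod_ring_add)
  then show ?case by (simp add: Suc distrib_right mod_simps del: funpow.simps)
qed

lemma funpow_card_mod_ring:
  fixes x :: "'p::finite mod_ring"
  shows "((+) x ^^ CARD('p)) 0 = 0"
  by (rule to_int_mod_ring_hom.injectivity)
    (simp add: to_int_mod_ring_funpow)

text \<open>
  A group of prime order is generated by each of its nonzero elements: solve \<open>n * d = x\<close>
  modulo the prime with a modular inverse of \<open>d\<close>.
\<close>

lemma mod_ring_cyclic:
  fixes d x :: "'p::finite mod_ring"
  assumes "prime CARD('p)" "d \<noteq> 0"
  obtains n where "x = ((+) d ^^ n) 0"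
proof -
  let ?p = "int CARD('p)" and ?d = "to_int_mod_ring d"
  have r: "0 \<le> to_int_mod_ring y \<and> to_int_mod_ring y < ?p" for y :: "'p mod_ring"
    using range_to_int_mod_ring[where ?'a = 'p] by (metis atLeastLessThan_iff rangeI)
  have "?d \<noteq> 0"
    using assms(2) by simp
  with r[of d] have "\<not> ?p dvd ?d"
    using zdvd_not_zless by force
  then have "coprime ?d ?p"
    using assms(1) by (metis coprime_commute prime_imp_coprime prime_nat_int_transfer)
  then obtain e where e: "[?d * e = 1] (mod ?p)"
    using cong_solve_coprime_int by blast
  let ?n = "nat ((e * to_int_mod_ring x) mod ?p)"
  have "(int ?n * ?d) mod ?p = (e * to_int_mod_ring x * ?d) mod ?p"
    by (simp add: mod_simps)
  also have "\<dots> = (to_int_mod_ring x * ((?d * e) mod ?p)) mod ?p"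
    by (simp add: mod_simps algebra_simps)
  also have "\<dots> = to_int_mod_ring x"
    using e r[of x] by (simp add: cong_def mod_simps)
  finally have "x = ((+) d ^^ ?n) 0"
    by (intro to_int_mod_ring_hom.injectivity) (simp add: to_int_mod_ring_funpow)
  then show thesis by (rule that)
qed

text \<open>
  If \<open>\<eta> x = \<eta> y\<close> then \<open>\<eta>\<close> is \<open>1\<close> at \<open>x - y\<close>; if this difference were nonzero, it would
  generate the group and \<open>\<eta>\<close> would be trivial.
\<close>

lemma character_inj:
  fixes \<eta> :: "'p::finite mod_ring \<Rightarrow> complex"
  assumes "prime CARD('p)" "character \<eta>" "\<eta> \<noteq> (\<lambda>_. 1)"
  shows "inj \<eta>"
proof (rule injI, rule ccontr)
  fix x y assume xy: "\<eta> x = \<eta> y" "x \<noteq> y"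
  have "\<eta> y = \<eta> (x - y) * \<eta> y"
    using assms(2) xy(1) unfolding character_def by (metis diff_add_cancel)
  moreover have "norm (\<eta> y) = 1"
    using assms(2) by (simp add: character_def)
  ultimately have one: "\<eta> (x - y) = 1" by auto
  have "\<eta> z = 1" for z
  proof -
    obtain n where "z = ((+) (x - y) ^^ n) 0"
      using mod_ring_cyclic[OF assms(1), of "x - y" z] xy(2) by auto
    then show ?thesis using character_funpow[OF assms(2)] one by simp
  qed
  with assms(3) show False by auto
qed

text \<open>
  A character takes values in the finite set of roots of unity of order dividing \<open>CARD('p)\<close>.
\<close>

lemma finite_characters:
  "finite {\<eta> :: 'p::finite mod_ring \<Rightarrow> complex. character \<eta>}"
proof -
  have "{\<eta> :: 'p mod_ring \<Rightarrow> complex. character \<eta>} \<subseteq> UNIV \<rightarrow>\<^sub>E {z. z ^ CARD('p) = 1}"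
  proof
    fix \<eta> :: "'p mod_ring \<Rightarrow> complex" assume "\<eta> \<in> {\<eta>. character \<eta>}"
    then show "\<eta> \<in> UNIV \<rightarrow>\<^sub>E {z. z ^ CARD('p) = 1}"
      using character_funpow[of \<eta> "CARD('p)"]
      by (auto simp: funpow_card_mod_ring character_0)
  qed
  then show ?thesis
    by (rule finite_subset) (auto intro!: finite_PiE finite_roots_unity)
qed

text \<open>
  Each configuration has order dividing \<open>CARD('p)\<close>, so \<open>\<psi>\<close> takes values in a finite set of roots of
  unity, where \<open>1\<close> is isolated. By continuity \<open>\<psi>\<close> is equal to \<open>1\<close> on a neighbourhood of \<open>0\<close>, and
  a basic neighbourhood in the product topology restricts finitely many coordinates only.
\<close>

lemma character_finite_support:
  fixes \<psi> :: "('m \<Rightarrow> 'p::finite mod_ring) \<Rightarrow> complex"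
  assumes "character \<psi>"
  obtains K where "finite K" "\<And>c. (\<forall>k\<in>K. c k = 0) \<Longrightarrow> \<psi> c = 1"
proof -
  let ?Z = "{z :: complex. z ^ CARD('p) = 1}"
  have root: "\<psi> c \<in> ?Z" for c
  proof -
    have "((+) c ^^ n) 0 = (\<lambda>m. ((+) (c m) ^^ n) 0)" for n
      by (induction n) (auto simp: fun_eq_iff)
    then have "((+) c ^^ CARD('p)) 0 = 0"
      by (simp add: funpow_card_mod_ring fun_eq_iff)
    then show ?thesis
      using character_funpow[OF assms, of "CARD('p)" c] character_0[OF assms] by simp
  qed
  \<comment> \<open>A neighbourhood of \<open>1\<close> that contains no other root of unity of the given order.\<close>
  have "open (- (?Z - {1}))"
    by (intro open_Compl finite_imp_closed finite_Diff finite_roots_unity) simp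
  then have "open (\<psi> -` (- (?Z - {1})))"
    using assms by (auto simp: character_def intro: open_vimage)
  moreover have "0 \<in> \<psi> -` (- (?Z - {1}))"
    by (simp add: character_0[OF assms])
  ultimately obtain X where X: "0 \<in> Pi\<^sub>E UNIV X" "finite {i. X i \<noteq> UNIV}"
      "Pi\<^sub>E UNIV X \<subseteq> \<psi> -` (- (?Z - {1}))"
    using product_topology_open_contains_basis[of "\<lambda>_. euclidean" UNIV "\<psi> -` (- (?Z - {1}))" 0]
    unfolding open_fun_def by auto
  show thesis
  proof (rule that[OF X(2)])
    fix c :: "'m \<Rightarrow> 'p mod_ring" assume c: "\<forall>k\<in>{i. X i \<noteq> UNIV}. c k = 0"
    have "c i \<in> X i" for i
      using X(1) c by (cases "X i = UNIV") (auto simp: PiE_def Pi_def)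
    then have "c \<in> \<psi> -` (- (?Z - {1}))"
      using X(3) by auto
    with root[of c] show "\<psi> c = 1" by auto
  qed
qed

definition single :: "'m \<Rightarrow> 'a::zero \<Rightarrow> 'm \<Rightarrow> 'a" where
  "single k x = (\<lambda>m. if m = k then x else 0)"

lemma character_coordinate:
  fixes \<psi> :: "('m \<Rightarrow> 'a::{discrete_topology, comm_monoid_add}) \<Rightarrow> complex"
  assumes "character \<psi>"
  shows "character (\<lambda>x. \<psi> (single k x))"
proof -
  have "single k (x + y) = single k x + single k y" for x y :: 'a
    by (auto simp: single_def fun_eq_iff)
  then show ?thesis
    using assms by (auto simp: character_def intro!: continuous_on_discrete)
qed

text \<open>
  Split \<open>c\<close> into its part on a finite support of \<open>\<psi>\<close>, which is a sum of one-site configurations,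
  and the rest, where \<open>\<psi>\<close> is \<open>1\<close>.
\<close>

lemma character_prod_coordinates:
  fixes \<psi> :: "('m \<Rightarrow> 'p::finite mod_ring) \<Rightarrow> complex"
  assumes "character \<psi>"
  defines "\<xi> \<equiv> \<lambda>k x. \<psi> (single k x)"
  defines "K \<equiv> {k. \<xi> k \<noteq> (\<lambda>_. 1)}"
  shows "finite K" "\<psi> c = (\<Prod>k\<in>K. \<xi> k (c k))"
proof -
  obtain L where L: "finite L" "\<And>c. (\<forall>k\<in>L. c k = 0) \<Longrightarrow> \<psi> c = 1"
    using character_finite_support[OF assms(1)] by metis
  have KL: "K \<subseteq> L"
    unfolding K_def \<xi>_def single_def by (auto intro!: L(2))
  then show "finite K" using L(1) finite_subset by auto
  have add: "\<psi> (x + y) = \<psi> x * \<psi> y" for x y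
    using assms(1) by (simp add: character_def)
  \<comment> \<open>Truncations to finite sets are built up one site at a time.\<close>
  have part: "\<psi> (\<lambda>m. if m \<in> F then c m else 0) = (\<Prod>k\<in>F. \<xi> k (c k))" if "finite F" for F
    using that
  proof (induction F)
    case empty
    then show ?case using character_0[OF assms(1)] by (simp add: zero_fun_def)
  next
    case (insert k F)
    have "(\<lambda>m. if m \<in> insert k F then c m else 0)
        = single k (c k) + (\<lambda>m. if m \<in> F then c m else 0)"
      using insert(2) by (auto simp: single_def fun_eq_iff)
    then show ?case using insert by (simp add: add \<xi>_def)
  qed
  have "c = (\<lambda>m. if m \<in> L then c m else 0) + (\<lambda>m. if m \<in> L then 0 else c m)"
    by (auto simp: fun_eq_iff)
  then have "\<psi> c = (\<Prod>k\<in>L. \<xi> k (c k)) * 1"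
    using add part[OF L(1)] L(2)[of "\<lambda>m. if m \<in> L then 0 else c m"] by metis
  also have "\<dots> = (\<Prod>k\<in>K. \<xi> k (c k))"
    using KL L(1) by (auto simp: K_def intro!: prod.mono_neutral_right)
  finally show "\<psi> c = (\<Prod>k\<in>K. \<xi> k (c k))" .
qed

text \<open>
  Evaluating any factorization on one-site configurations recovers its factors, and with them the
  set of sites. This uniqueness is what makes \<open>char_rank\<close>, a definite description, the
  cardinality of the set found above.
\<close>

lemma character_rank_factorization:
  fixes \<psi> :: "('m \<Rightarrow> 'p::finite mod_ring) \<Rightarrow> complex"
  assumes "character \<psi>"
  obtains K \<xi> where "finite K" "card K = char_rank \<psi>"
    "\<And>k. k \<in> K \<Longrightarrow> character (\<xi> k) \<and> \<xi> k \<noteq> (\<lambda>_. 1)"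
    "\<And>c. \<psi> c = (\<Prod>k\<in>K. \<xi> k (c k))"
proof -
  define \<xi> where "\<xi> = (\<lambda>k x. \<psi> (single k x))"
  define K where "K = {k. \<xi> k \<noteq> (\<lambda>_. 1)}"
  have fin: "finite K" and prod: "\<psi> c = (\<Prod>k\<in>K. \<xi> k (c k))" for c
    unfolding K_def \<xi>_def by (rule character_prod_coordinates[OF assms])+
  have char: "character (\<xi> k)" for k
    unfolding \<xi>_def by (rule character_coordinate[OF assms])
  have uniq: "L = K" if L: "finite L" "\<forall>k\<in>L. character (\<eta> k) \<and> \<eta> k \<noteq> (\<lambda>_. 1)"
    "\<forall>a. \<psi> a = (\<Prod>k\<in>L. \<eta> k (a k))" for L and \<eta> :: "'m \<Rightarrow> 'p mod_ring \<Rightarrow> complex"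
  proof -
    have "\<xi> k x = (if k \<in> L then \<eta> k x else 1)" for k x
    proof -
      have "\<xi> k x = (\<Prod>l\<in>L. if l = k then \<eta> k x else 1)"
        unfolding \<xi>_def L(3)[rule_format] single_def
        using L(2) by (intro prod.cong) (auto simp: character_0)
      then show ?thesis using L(1) by simp
    qed
    then show ?thesis
      using L(2) unfolding K_def by (auto simp: fun_eq_iff)
  qed
  have "char_rank \<psi> = card K"
    unfolding char_rank_def
  proof (rule the_equality)
    show "\<exists>L \<eta>. finite L \<and> card L = card K \<and>
        (\<forall>k\<in>L. character (\<eta> k) \<and> \<eta> k \<noteq> (\<lambda>_. 1)) \<and> (\<forall>a. \<psi> a = (\<Prod>k\<in>L. \<eta> k (a k)))"
      using fin prod char by (intro exI[of _ K] exI[of _ \<xi>]) (simp add: K_def)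
  qed (use uniq in blast)
  then have "card K = char_rank \<psi>" ..
  moreover have "character (\<xi> k) \<and> \<xi> k \<noteq> (\<lambda>_. 1)" if "k \<in> K" for k
    using that char unfolding K_def by blast
  ultimately show thesis
    by (rule that[OF fin _ _ prod])
qed

section \<open>Cylinders and finitely determined functions\<close>

definition depends_on :: "'m set \<Rightarrow> (('m \<Rightarrow> 'a) \<Rightarrow> 'b) \<Rightarrow> bool" where
  "depends_on R F \<longleftrightarrow> (\<forall>c c'. (\<forall>m\<in>R. c m = c' m) \<longrightarrow> F c = F c')"

lemma mem_cylinder_restrict [simp]:
  "c \<in> cylinder R (restrict b R) \<longleftrightarrow> (\<forall>m\<in>R. c m = b m)"
  by (auto simp: cylinder_def restrict_def fun_eq_iff)

lemma borel_coordinate [measurable]: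
  "(\<lambda>c :: 'm \<Rightarrow> 'a::topological_space. c m) \<in> borel_measurable borel"
  by (intro borel_measurable_continuous_onI) (simp add: continuous_on_product_coordinates)

lemma borel_coordinate_eq:
  "{c :: 'm \<Rightarrow> 'a::discrete_topology. c m = a} \<in> sets borel"
proof -
  have "(\<lambda>c :: 'm \<Rightarrow> 'a. c m) -` {a} \<inter> space borel \<in> sets borel"
    by (rule measurable_sets[OF borel_coordinate]) simp
  moreover have "(\<lambda>c :: 'm \<Rightarrow> 'a. c m) -` {a} \<inter> space borel = {c. c m = a}"
    by auto
  ultimately show ?thesis by simp
qed

lemma borel_cylinder:
  fixes b :: "'m \<Rightarrow> 'a::discrete_topology"
  assumes "finite R"
  shows "cylinder R (restrict b R) \<in> sets borel"
proof -
  have "cylinder R (restrict b R) = (\<Inter>m\<in>R. {c. c m = b m}) \<inter> space borel"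
    by auto
  also have "\<dots> \<in> sets borel"
    using assms by (cases "R = {}") (auto intro!: sets.finite_INT borel_coordinate_eq)
  finally show ?thesis .
qed

lemma integral_finite_dependence:
  fixes F :: "('m \<Rightarrow> 'a::{finite, discrete_topology}) \<Rightarrow> complex"
  assumes "prob_space \<mu>" "sets \<mu> = sets borel"
    and "finite R" "depends_on R F"
  shows "(LINT c|\<mu>. F c) =
    (\<Sum>r \<in> R \<rightarrow>\<^sub>E UNIV. measure \<mu> (cylinder R r) *\<^sub>R F r)"
proof -
  interpret prob_space \<mu> by fact
  have fin: "finite (R \<rightarrow>\<^sub>E (UNIV :: 'a set))"
    using assms(3) by (intro finite_PiE) auto
  have meas: "cylinder R r \<in> sets \<mu>" if "r \<in> R \<rightarrow>\<^sub>E UNIV" for r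
    using borel_cylinder[OF assms(3), of r] that by (simp add: assms(2) PiE_restrict)
  have "F c = (\<Sum>r \<in> R \<rightarrow>\<^sub>E UNIV. indicator (cylinder R r) c *\<^sub>R F r)" for c
  proof -
    have "(\<Sum>r \<in> R \<rightarrow>\<^sub>E UNIV. indicator (cylinder R r) c *\<^sub>R F r)
        = (\<Sum>r \<in> R \<rightarrow>\<^sub>E UNIV. if r = restrict c R then F r else 0)"
      by (intro sum.cong) (auto simp: cylinder_def indicator_def)
    also have "\<dots> = F (restrict c R)"
      using fin by simp
    also have "\<dots> = F c"
      using assms(4) unfolding depends_on_def by force
    finally show ?thesis by simp
  qed
  then have "(LINT c|\<mu>. F c)
      = (LINT c|\<mu>. (\<Sum>r \<in> R \<rightarrow>\<^sub>E UNIV. indicator (cylinder R r) c *\<^sub>R F r))"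
    by (rule Bochner_Integration.integral_cong[OF refl])
  also have "\<dots> = (\<Sum>r \<in> R \<rightarrow>\<^sub>E UNIV. LINT c|\<mu>. indicator (cylinder R r) c *\<^sub>R F r)"
    using meas by (intro Bochner_Integration.integral_sum)
      (simp add: integrable_real_indicator emeasure_eq_measure)
  also have "\<dots> = (\<Sum>r \<in> R \<rightarrow>\<^sub>E UNIV. measure \<mu> (cylinder R r) *\<^sub>R F r)"
    using meas by (intro sum.cong) (simp_all add: emeasure_eq_measure)
  finally show ?thesis .
qed

section \<open>Conditioning on the neighbours of a site\<close>

text \<open>
  The conditional probability of the letter \<open>a\<close> at \<open>j\<close> given that the configuration agrees with
  \<open>b\<close> on \<open>V\<close>. If this condition has mass \<open>0\<close>, the value is \<open>0\<close>, so that bounds on averages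
  against this law hold for every \<open>b\<close>.
\<close>

definition site_law ::
  "('m \<Rightarrow> 'a) measure \<Rightarrow> 'm set \<Rightarrow> 'm \<Rightarrow> ('m \<Rightarrow> 'a) \<Rightarrow> 'a \<Rightarrow> real" where
  "site_law \<mu> V j b a = measure \<mu> (cylinder V (restrict b V) \<inter> {c. c j = a})
      / measure \<mu> (cylinder V (restrict b V))"

lemma site_law_cong:
  assumes "\<And>m. m \<in> V \<Longrightarrow> b m = b' m"
  shows "site_law \<mu> V j b = site_law \<mu> V j b'"
proof -
  have "restrict b V = restrict b' V" using assms by auto
  then show ?thesis unfolding site_law_def by simp
qed

text \<open>
  The Markov property for \<open>U = {j}\<close>, multiplied by the mass of the pattern on \<open>V\<close>. The boundary of \<open>{j}\<close> is \<open>V\<close>, and the sites of \<open>R\<close> outside \<open>V\<close> lie outside the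
  neighbourhood \<open>j + B\<close>. If \<open>V\<close> carries a pattern of mass \<open>0\<close>, both sides vanish.
\<close>

lemma markov_site:
  fixes \<mu> :: "('m::ab_group_add \<Rightarrow> 'a::{finite, discrete_topology}) measure"
  assumes "prob_space \<mu>" and sets: "sets \<mu> = sets borel"
    and mrf: "markov_random_field B \<mu>"
    and "finite R" "j \<notin> R" and V: "V = (+) j ` (B - {0})" "V \<subseteq> R"
  shows "measure \<mu> (cylinder R (restrict b R) \<inter> {c. c j = a})
    = measure \<mu> (cylinder R (restrict b R)) * site_law \<mu> V j b a"
proof -
  interpret prob_space \<mu> by fact
  let ?V = "cylinder V (restrict b V)" and ?R = "cylinder R (restrict b R)"
  have "finite V" using V(2) assms(4) finite_subset by auto
  have mV: "?V \<in> sets \<mu>" and mR: "?R \<in> sets \<mu>" and ma: "{c. c j = a} \<in> sets \<mu>"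
    using borel_cylinder[OF \<open>finite V\<close>] borel_cylinder[OF assms(4)] sets
    by (auto simp: borel_coordinate_eq)
  have RV: "?R \<subseteq> ?V" using V(2) by (auto simp: subset_eq)
  show ?thesis
  proof (cases "measure \<mu> ?V = 0")
    case True
    then have "measure \<mu> ?R = 0"
      using finite_measure_mono[OF RV mV] measure_nonneg[of \<mu> ?R] by linarith
    moreover from this have "measure \<mu> (?R \<inter> {c. c j = a}) = 0"
      using finite_measure_mono[OF Int_lower1 mR, of "{c. c j = a}"]
        measure_nonneg[of \<mu> "?R \<inter> {c. c j = a}"] by linarith
    ultimately show ?thesis by simp
  next
    case False
    then have pos: "measure \<mu> ?V > 0" by (simp add: zero_less_measure_iff)
    let ?\<nu> = "conditional \<mu> V (restrict b V)" and ?W = "UNIV - nbhd B {j}"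
    have setsc: "sets ?\<nu> = sets borel" by (simp add: conditional_def sets)
    have sp: "space \<mu> = UNIV" "space ?\<nu> = UNIV"
      using sets_eq_imp_space_eq[OF sets] sets_eq_imp_space_eq[OF setsc] by auto
    have bd: "boundary B {j} = V"
      unfolding boundary_def nbhd_def V(1) by (auto simp: image_iff)
    have W: "R - V \<subseteq> ?W"
      unfolding nbhd_def V(1) using assms(5) by (auto simp: image_iff)
    have cond: "measure ?\<nu> E = measure \<mu> (?V \<inter> E) / measure \<mu> ?V" if "E \<in> sets borel" for E
      unfolding conditional_def using that False mV sets
      by (subst measure_uniform_measure) (auto simp: emeasure_eq_measure)
    have mres: "(\<lambda>c. restrict c I) \<in> measurable ?\<nu> (Pi\<^sub>M I (\<lambda>_. borel))" for I
      unfolding measurable_cong_sets[OF setsc refl]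
      by (rule measurable_restrict) (rule borel_coordinate)
    have marg: "measure (marginal ?\<nu> I) X = measure \<mu> (?V \<inter> {c. restrict c I \<in> X}) / measure \<mu> ?V"
      if X: "X \<in> sets (Pi\<^sub>M I (\<lambda>_. borel))" for I X
    proof -
      have "measure (marginal ?\<nu> I) X = measure ?\<nu> {c. restrict c I \<in> X}"
        unfolding marginal_def measure_distr[OF mres X] by (simp add: sp vimage_def)
      also have "\<dots> = measure \<mu> (?V \<inter> {c. restrict c I \<in> X}) / measure \<mu> ?V"
        using measurable_sets[OF mres X] by (intro cond) (simp add: sp setsc vimage_def)
      finally show ?thesis .
    qed
    define X where "X = {x \<in> space (Pi\<^sub>M {j} (\<lambda>_. borel)). x j \<in> {a}}"
    define Y where "Y = {y \<in> space (Pi\<^sub>M ?W (\<lambda>_. borel)). \<forall>m\<in>R - V. y m \<in> {b m}}"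
    have X: "X \<in> sets (Pi\<^sub>M {j} (\<lambda>_. borel))"
      unfolding X_def by (intro sets_Collect_single') auto
    have "finite (R - V)" using assms(4) by auto
    have coordY: "{y \<in> space (Pi\<^sub>M ?W (\<lambda>_. borel)). y m \<in> {b m}} \<in> sets (Pi\<^sub>M ?W (\<lambda>_. borel))"
      if "m \<in> R - V" for m
      using W that by (intro sets_Collect_single') auto
    then have Y: "Y \<in> sets (Pi\<^sub>M ?W (\<lambda>_. borel))"
      unfolding Y_def using \<open>finite (R - V)\<close> by (rule sets.sets_Collect_finite_All)
    \<comment> \<open>The sets \<open>X\<close> and \<open>Y\<close> live on coordinates in \<open>{j}\<close> and \<open>?W\<close>; these are the events of
      configurations that they describe.\<close>
    have eX: "{c. restrict c {j} \<in> X} = {c. c j = a}"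
      by (auto simp: X_def space_PiM)
    have eY: "{c. restrict c ?W \<in> Y} = cylinder (R - V) (restrict b (R - V))"
      using W by (auto simp: Y_def space_PiM subset_eq)
    have eR: "?V \<inter> {c. restrict c ?W \<in> Y} = ?R"
      unfolding eY using V(2) by (auto simp: subset_eq; blast)
    have mY: "cylinder (R - V) (restrict b (R - V)) \<in> sets borel"
      using \<open>finite (R - V)\<close> by (rule borel_cylinder)
    let ?E = "{c. restrict c {j} \<in> X} \<inter> {c. restrict c ?W \<in> Y}"
    have mE: "?E \<in> sets borel"
      unfolding eX eY using ma mY sets by auto
    have VE: "?V \<inter> ?E = ?R \<inter> {c. c j = a}"
      unfolding eX using eR by blast
    have "measure ?\<nu> ?E = measure (marginal ?\<nu> {j}) X * measure (marginal ?\<nu> ?W) Y"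
      by (rule mrf[unfolded markov_random_field_def Let_def, rule_format, of _ "{j}",
            unfolded bd, OF _ pos X Y]) auto
    then have "measure \<mu> (?R \<inter> {c. c j = a}) / measure \<mu> ?V
        = measure \<mu> (?V \<inter> {c. c j = a}) / measure \<mu> ?V * (measure \<mu> ?R / measure \<mu> ?V)"
      unfolding cond[OF mE, unfolded VE] marg[OF X] marg[OF Y] eR unfolding eX .
    then show ?thesis
      using False by (simp add: site_law_def field_simps)
  qed
qed

text \<open>
  Conditioning on the pattern \<open>r\<close> of all sites of \<open>R\<close> turns \<open>f (c j)\<close> into its conditional mean,
  which by the Markov property is determined by the part of \<open>r\<close> on \<open>V\<close>. Everything depends on
  finitely many coordinates, so conditional expectations are finite sums over cylinders.
\<close>

lemma integral_condition_site:
  fixes \<mu> :: "('m::ab_group_add \<Rightarrow> 'a::{finite, discrete_topology}) measure"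
    and H :: "('m \<Rightarrow> 'a) \<Rightarrow> complex"
  assumes "prob_space \<mu>" and sets: "sets \<mu> = sets borel"
    and mrf: "markov_random_field B \<mu>"
    and R: "finite R" "j \<notin> R" and V: "V = (+) j ` (B - {0})" "V \<subseteq> R"
    and H: "depends_on R H"
  shows "(LINT c|\<mu>. f (c j) * H c) = (LINT c|\<mu>. (\<Sum>a\<in>UNIV. site_law \<mu> V j c a *\<^sub>R f a) * H c)"
proof -
  interpret prob_space \<mu> by fact
  let ?G = "\<lambda>c. (\<Sum>a\<in>UNIV. site_law \<mu> V j c a *\<^sub>R f a) * H c"
  have fin: "finite (R \<rightarrow>\<^sub>E (UNIV :: 'a set))"
    using R(1) by (intro finite_PiE) auto
  have G: "depends_on R ?G"
    unfolding depends_on_def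
  proof (intro allI impI)
    fix c c' :: "'m \<Rightarrow> 'a" assume cc: "\<forall>m\<in>R. c m = c' m"
    then have "site_law \<mu> V j c = site_law \<mu> V j c'" "H c = H c'"
      using V(2) H by (auto simp: depends_on_def intro!: site_law_cong)
    then show "?G c = ?G c'" by simp
  qed
  have meas: "cylinder R r \<inter> {c. c j = a} \<in> sets \<mu>" if "r \<in> R \<rightarrow>\<^sub>E UNIV" for r a
    using borel_cylinder[OF R(1), of r] that
    by (auto simp: sets PiE_restrict borel_coordinate_eq)
  have "f (c j) * H c = (\<Sum>r \<in> R \<rightarrow>\<^sub>E UNIV. \<Sum>a\<in>UNIV.
      indicator (cylinder R r \<inter> {c. c j = a}) c *\<^sub>R (f a * H r))" for c
  proof -
    have "(\<Sum>r \<in> R \<rightarrow>\<^sub>E UNIV. \<Sum>a\<in>UNIV. indicator (cylinder R r \<inter> {c. c j = a}) c *\<^sub>R (f a * H r))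
        = (\<Sum>r \<in> R \<rightarrow>\<^sub>E UNIV. \<Sum>a\<in>UNIV.
            if a = c j then (if r = restrict c R then f a * H r else 0) else 0)"
      by (intro sum.cong) (auto simp: cylinder_def indicator_def)
    also have "\<dots> = f (c j) * H (restrict c R)"
      using fin by simp
    also have "H (restrict c R) = H c"
      using H unfolding depends_on_def by force
    finally show ?thesis by simp
  qed
  then have "(LINT c|\<mu>. f (c j) * H c) = (LINT c|\<mu>. (\<Sum>r \<in> R \<rightarrow>\<^sub>E UNIV. \<Sum>a\<in>UNIV.
      indicator (cylinder R r \<inter> {c. c j = a}) c *\<^sub>R (f a * H r)))"
    by (rule Bochner_Integration.integral_cong[OF refl])
  also have "\<dots> = (\<Sum>r \<in> R \<rightarrow>\<^sub>E UNIV. LINT c|\<mu>. (\<Sum>a\<in>UNIV.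
      indicator (cylinder R r \<inter> {c. c j = a}) c *\<^sub>R (f a * H r)))"
    using meas by (intro Bochner_Integration.integral_sum Bochner_Integration.integrable_sum)
      (simp add: emeasure_eq_measure)
  also have "\<dots> = (\<Sum>r \<in> R \<rightarrow>\<^sub>E UNIV. \<Sum>a\<in>UNIV. LINT c|\<mu>.
      indicator (cylinder R r \<inter> {c. c j = a}) c *\<^sub>R (f a * H r))"
    using meas by (intro sum.cong refl Bochner_Integration.integral_sum)
      (simp add: emeasure_eq_measure)
  also have "\<dots> = (\<Sum>r \<in> R \<rightarrow>\<^sub>E UNIV. \<Sum>a\<in>UNIV.
      measure \<mu> (cylinder R r \<inter> {c. c j = a}) *\<^sub>R (f a * H r))"
    using meas by (intro sum.cong refl) (simp add: emeasure_eq_measure)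
  also have "\<dots> = (\<Sum>r \<in> R \<rightarrow>\<^sub>E UNIV. measure \<mu> (cylinder R r) *\<^sub>R ?G r)"
  proof (rule sum.cong[OF refl])
    fix r :: "'m \<Rightarrow> 'a" assume "r \<in> R \<rightarrow>\<^sub>E UNIV"
    then have "measure \<mu> (cylinder R r \<inter> {c. c j = a}) = measure \<mu> (cylinder R r) * site_law \<mu> V j r a" for a
      using markov_site[OF assms(1) sets mrf R V, of r a] by (simp add: PiE_restrict)
    then show "(\<Sum>a\<in>UNIV. measure \<mu> (cylinder R r \<inter> {c. c j = a}) *\<^sub>R (f a * H r))
        = measure \<mu> (cylinder R r) *\<^sub>R ?G r"
      by (simp add: scaleR_sum_right sum_distrib_right)
  qed
  also have "\<dots> = (LINT c|\<mu>. ?G c)"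
    by (rule integral_finite_dependence[OF assms(1) sets R(1) G, symmetric])
  finally show ?thesis .
qed

text \<open>
  Induction on \<open>J\<close>: the factor at a new site \<open>j\<close> is replaced by its conditional mean, which has
  norm at most \<open>\<rho>\<close> and depends only on the neighbours of \<open>j\<close>. Since \<open>J\<close> is separated, these
  avoid \<open>J\<close>, so the mean can be absorbed into \<open>H\<close>. The function \<open>H\<close> is there to
  make this induction work.
\<close>

lemma integral_separated_bound:
  fixes \<mu> :: "('m::ab_group_add \<Rightarrow> 'a::{finite, discrete_topology}) measure"
    and H :: "('m \<Rightarrow> 'a) \<Rightarrow> complex"
  assumes "prob_space \<mu>" "sets \<mu> = sets borel" "markov_random_field B \<mu>" "finite B"
    and "finite J" and "\<And>i j. i \<in> J \<Longrightarrow> j \<in> J \<Longrightarrow> i \<noteq> j \<Longrightarrow> i - j \<notin> B"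
    and "\<And>j b. j \<in> J \<Longrightarrow>
      norm (\<Sum>a\<in>UNIV. site_law \<mu> ((+) j ` (B - {0})) j b a *\<^sub>R f j a) \<le> \<rho>"
    and "\<rho> \<ge> 0"
    and "finite R" "R \<inter> J = {}" "depends_on R H" "\<And>c. norm (H c) \<le> C"
  shows "norm (LINT c|\<mu>. (\<Prod>j\<in>J. f j (c j)) * H c) \<le> \<rho> ^ card J * C"
  using assms(5-7,9-)
proof (induction J arbitrary: R H C rule: finite_induct)
  case empty
  interpret prob_space \<mu> by fact
  have "norm (LINT c|\<mu>. H c) \<le> (\<Sum>r \<in> R \<rightarrow>\<^sub>E UNIV. measure \<mu> (cylinder R r) * C)"
    unfolding integral_finite_dependence[OF assms(1,2) empty(3,5)]
    by (intro order_trans[OF norm_sum] sum_mono) (simp add: mult_left_mono empty.prems(6))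
  also have "\<dots> = Re (LINT c|\<mu>. complex_of_real C)"
    by (subst integral_finite_dependence[OF assms(1,2) empty(3)])
      (auto simp: depends_on_def)
  finally show ?case by (simp add: prob_space)
next
  case (insert j J)
  let ?V = "(+) j ` (B - {0})"
  let ?g = "\<lambda>c. \<Sum>a\<in>UNIV. site_law \<mu> ?V j c a *\<^sub>R f j a"
  have VJ: "?V \<inter> insert j J = {}"
  proof -
    have "j + b \<notin> insert j J" if "b \<in> B" "b \<noteq> 0" for b
      using insert.prems(1)[of "j + b" j] that by auto
    then show ?thesis by auto
  qed
  have dep: "depends_on (R \<union> J \<union> ?V) (\<lambda>c. (\<Prod>i\<in>J. f i (c i)) * H c)"
    using insert.prems(5) unfolding depends_on_def by (auto intro!: arg_cong2[where f = "(*)"] prod.cong)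
  have depg: "depends_on (R \<union> ?V) (\<lambda>c. ?g c * H c)"
    unfolding depends_on_def
  proof (intro allI impI)
    fix c c' :: "'m \<Rightarrow> 'a" assume "\<forall>m\<in>R \<union> ?V. c m = c' m"
    then have "site_law \<mu> ?V j c = site_law \<mu> ?V j c'" "H c = H c'"
      using insert.prems(5) by (auto simp: depends_on_def intro!: site_law_cong)
    then show "?g c * H c = ?g c' * H c'" by simp
  qed
  have "(LINT c|\<mu>. (\<Prod>i\<in>insert j J. f i (c i)) * H c)
      = (LINT c|\<mu>. f j (c j) * ((\<Prod>i\<in>J. f i (c i)) * H c))"
    using insert.hyps by (simp add: mult.assoc)
  also have "\<dots> = (LINT c|\<mu>. ?g c * ((\<Prod>i\<in>J. f i (c i)) * H c))"
    using insert.hyps insert.prems(3,4) VJ assms(4)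
    by (intro integral_condition_site[OF assms(1-3) _ _ refl _ dep]) auto
  also have "\<dots> = (LINT c|\<mu>. (\<Prod>i\<in>J. f i (c i)) * (?g c * H c))"
    by (simp add: mult_ac)
  finally have eq: "(LINT c|\<mu>. (\<Prod>i\<in>insert j J. f i (c i)) * H c)
      = (LINT c|\<mu>. (\<Prod>i\<in>J. f i (c i)) * (?g c * H c))" .
  have "norm (LINT c|\<mu>. (\<Prod>i\<in>J. f i (c i)) * (?g c * H c)) \<le> \<rho> ^ card J * (\<rho> * C)"
  proof (rule insert.IH[OF _ _ _ _ depg])
    show "norm (?g c * H c) \<le> \<rho> * C" for c
      using insert.prems(2)[of j c] insert.prems(6)[of c] assms(8)
      by (simp add: norm_mult mult_mono)
  qed (use insert.prems VJ assms(4) in auto)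
  then show ?case
    using insert.hyps eq by (simp add: mult_ac)
qed

section \<open>Conditional means of characters at a site\<close>

text \<open>
  The variance of \<open>f\<close> under the weights \<open>q\<close> is \<open>1 - (norm z)\<^sup>2\<close>, where \<open>z\<close> is the mean. It is
  positive because \<open>f\<close> is not constant on the points of positive weight.
\<close>

lemma norm_convex_sum_unit_less_1:
  fixes f :: "'a::finite \<Rightarrow> complex" and q :: "'a \<Rightarrow> real"
  assumes "\<And>a. q a \<ge> 0" "(\<Sum>a\<in>UNIV. q a) = 1" "\<And>a. norm (f a) = 1"
    and "q x > 0" "q y > 0" "f x \<noteq> f y"
  shows "norm (\<Sum>a\<in>UNIV. q a *\<^sub>R f a) < 1"
proof -
  define z where "z = (\<Sum>a\<in>UNIV. q a *\<^sub>R f a)"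
  have "(\<Sum>a\<in>UNIV. q a * (norm (f a - z))\<^sup>2)
      = (\<Sum>a\<in>UNIV. q a + q a * (norm z)\<^sup>2 - 2 * ((q a *\<^sub>R f a) \<bullet> z))"
  proof (intro sum.cong refl)
    fix a
    have "(norm (f a - z))\<^sup>2 = 1 + (norm z)\<^sup>2 - 2 * (f a \<bullet> z)"
      using assms(3)[of a]
      by (simp add: power2_norm_eq_inner inner_diff inner_commute norm_eq_1)
    then show "q a * (norm (f a - z))\<^sup>2 = q a + q a * (norm z)\<^sup>2 - 2 * ((q a *\<^sub>R f a) \<bullet> z)"
      by (simp only: inner_scaleR_left) (simp add: algebra_simps)
  qed
  also have "\<dots> = 1 + (norm z)\<^sup>2 - 2 * (z \<bullet> z)"
    by (simp add: sum.distrib sum_subtractf assms(2) z_def inner_sum_left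
        flip: sum_distrib_left sum_distrib_right)
  finally have var: "(\<Sum>a\<in>UNIV. q a * (norm (f a - z))\<^sup>2) = 1 - (norm z)\<^sup>2"
    by (simp add: power2_norm_eq_inner)
  obtain w where "q w > 0" "f w \<noteq> z"
    using assms(4-6) by metis
  then have "0 < (\<Sum>a\<in>UNIV. q a * (norm (f a - z))\<^sup>2)"
    using assms(1) by (intro sum_pos2[of _ w]) auto
  with var have "(norm z)\<^sup>2 < 1" by simp
  then show ?thesis
    by (simp add: z_def abs_square_less_1)
qed

lemma site_law_sum:
  fixes \<mu> :: "('m \<Rightarrow> 'a::{finite, discrete_topology}) measure"
  assumes "prob_space \<mu>" "sets \<mu> = sets borel" "finite V"
    and "measure \<mu> (cylinder V (restrict b V)) > 0"
  shows "(\<Sum>a\<in>UNIV. site_law \<mu> V j b a) = 1"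
proof -
  interpret prob_space \<mu> by fact
  have meas: "range (\<lambda>a. cylinder V (restrict b V) \<inter> {c. c j = a}) \<subseteq> sets \<mu>"
    using borel_cylinder[OF assms(3), of b] by (auto simp: assms(2) borel_coordinate_eq)
  have disj: "disjoint_family (\<lambda>a. cylinder V (restrict b V) \<inter> {c. c j = a})"
    by (auto simp: disjoint_family_on_def)
  have "(\<Sum>a\<in>UNIV. measure \<mu> (cylinder V (restrict b V) \<inter> {c. c j = a}))
      = measure \<mu> (\<Union>a. cylinder V (restrict b V) \<inter> {c. c j = a})"
    by (rule finite_measure_finite_Union[OF finite meas disj, symmetric])
  also have "(\<Union>a. cylinder V (restrict b V) \<inter> {c. c j = a}) = cylinder V (restrict b V)"
    by auto
  finally show ?thesis
    using assms(4) unfolding site_law_def by (simp flip: sum_divide_distrib del: restrict_apply)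
qed

lemma site_law_shift:
  fixes \<mu> :: "('m::ab_group_add \<Rightarrow> 'a::discrete_topology) measure"
  assumes sets: "sets \<mu> = sets borel" and shift: "shift_invariant \<mu>" and "finite S"
  shows "site_law \<mu> ((+) j ` S) j b = site_law \<mu> S 0 (\<lambda>m. b (m + j))"
proof
  fix a
  let ?T = "\<lambda>c m. c (m + j)" and ?b = "\<lambda>m. b (m + j)"
  have "?T \<in> borel_measurable borel"
    by (intro borel_measurable_continuous_onI continuous_on_coordinatewise_then_product
        continuous_on_product_coordinates)
  then have T: "?T \<in> measurable \<mu> \<mu>"
    using measurable_cong_sets[OF sets sets] by blast
  have sp: "space \<mu> = UNIV" using sets_eq_imp_space_eq[OF sets] by simp
  have inv: "measure \<mu> E = measure \<mu> (?T -` E)" if "E \<in> sets \<mu>" for E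
    using measure_distr[OF T that] shift sp by (simp add: shift_invariant_def)
  have cyl: "cylinder S (restrict ?b S) \<in> sets \<mu>" "{c. c 0 = a} \<in> sets \<mu>"
    using borel_cylinder[OF assms(3)] borel_coordinate_eq sets by auto
  have v: "?T -` cylinder S (restrict ?b S) = cylinder ((+) j ` S) (restrict b ((+) j ` S))"
    by (auto simp: add.commute)
  have v': "?T -` (cylinder S (restrict ?b S) \<inter> {c. c 0 = a})
      = cylinder ((+) j ` S) (restrict b ((+) j ` S)) \<inter> {c. c j = a}"
    unfolding vimage_Int v by auto
  show "site_law \<mu> ((+) j ` S) j b a = site_law \<mu> S 0 ?b a"
    using inv[OF cyl(1)] inv[OF sets.Int[OF cyl]] unfolding site_law_def v v' by simp
qed

text \<open>
  For one boundary pattern and one nontrivial character the conditional mean at the origin has norm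
  less than \<open>1\<close>; there are finitely many such pairs, and \<open>\<rho>\<close> is the maximum over them.
\<close>

lemma locally_free_contraction:
  fixes \<mu> :: "('m::ab_group_add \<Rightarrow> 'p::finite mod_ring) measure"
  assumes "prime CARD('p)" "finite B" "prob_space \<mu>" and sets: "sets \<mu> = sets borel"
    and lf: "locally_free B \<mu>"
  obtains \<rho> where "0 \<le> \<rho>" "\<rho> < 1"
    "\<And>b \<eta>. character \<eta> \<Longrightarrow> \<eta> \<noteq> (\<lambda>_. 1) \<Longrightarrow>
      norm (\<Sum>a\<in>UNIV. site_law \<mu> (B - {0}) 0 b a *\<^sub>R \<eta> a) \<le> \<rho>"
proof -
  interpret prob_space \<mu> by fact
  let ?S = "B - {0}"
  let ?h = "\<lambda>b \<eta>. norm (\<Sum>a\<in>UNIV. site_law \<mu> ?S 0 b a *\<^sub>R \<eta> a)"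
  let ?X = "{\<eta> :: 'p mod_ring \<Rightarrow> complex. character \<eta> \<and> \<eta> \<noteq> (\<lambda>_. 1)}"
  \<comment> \<open>The element \<open>0\<close> makes the maximum defined and nonnegative.\<close>
  define A where "A = insert 0 ((\<lambda>(b, \<eta>). ?h b \<eta>) ` ((?S \<rightarrow>\<^sub>E UNIV) \<times> ?X))"
  have "finite S'" if "S' \<subseteq> {\<eta> :: 'p mod_ring \<Rightarrow> complex. character \<eta>}" for S'
    using that finite_characters finite_subset by blast
  then have "finite ?X" by auto
  then have finA: "finite A"
    unfolding A_def using assms(2) by (intro finite.insertI finite_imageI finite_cartesian_product finite_PiE) auto
  have less: "?h b \<eta> < 1" if \<eta>: "character \<eta>" "\<eta> \<noteq> (\<lambda>_. 1)" for b \<eta>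
  proof (cases "measure \<mu> (cylinder ?S (restrict b ?S)) > 0")
    case False
    then have "measure \<mu> (cylinder ?S (restrict b ?S)) = 0"
      using measure_nonneg[of \<mu> "cylinder ?S (restrict b ?S)"] by linarith
    then show ?thesis by (simp add: site_law_def)
  next
    case True
    let ?\<nu> = "conditional \<mu> ?S (restrict b ?S)"
    have "finite ?S" using assms(2) by auto
    have law: "measure (distr ?\<nu> borel (\<lambda>c. c 0)) {a} = site_law \<mu> ?S 0 b a" for a
    proof -
      have setsc: "sets ?\<nu> = sets borel" by (simp add: conditional_def sets)
      have sp: "space ?\<nu> = UNIV"
        using sets_eq_imp_space_eq[OF setsc] by simp
      have coord: "(\<lambda>c. c 0) \<in> measurable ?\<nu> borel"
        unfolding measurable_cong_sets[OF setsc refl] by (rule borel_coordinate)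
      have "measure (distr ?\<nu> borel (\<lambda>c. c 0)) {a} = measure ?\<nu> {c. c 0 = a}"
        using measure_distr[OF coord, of "{a}"] by (simp add: sp vimage_def)
      also have "\<dots> = site_law \<mu> ?S 0 b a"
        unfolding conditional_def site_law_def using True sets borel_cylinder[OF \<open>finite ?S\<close>, of b]
        by (subst measure_uniform_measure) (auto simp: emeasure_eq_measure borel_coordinate_eq)
      finally show ?thesis .
    qed
    have "restrict b ?S \<in> ?S \<rightarrow>\<^sub>E UNIV" by auto
    then have "card {a. site_law \<mu> ?S 0 b a > 0} \<ge> 2"
      using lf True unfolding locally_free_def Let_def law[symmetric] by blast
    then obtain x y where xy: "site_law \<mu> ?S 0 b x > 0" "site_law \<mu> ?S 0 b y > 0" "x \<noteq> y"
      using card_le_Suc0_iff_eq[of "{a. site_law \<mu> ?S 0 b a > 0}"] by fastforce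
    then have "\<eta> x \<noteq> \<eta> y"
      using character_inj[OF assms(1) \<eta>] by (auto dest: injD)
    then show ?thesis
      using xy \<eta> site_law_sum[OF assms(3) sets \<open>finite ?S\<close> True]
      by (intro norm_convex_sum_unit_less_1[of _ _ x y])
        (auto simp: character_def, auto simp: site_law_def)
  qed
  show thesis
  proof (rule that[of "Max A"])
    show "0 \<le> Max A" using finA by (intro Max_ge) (auto simp: A_def)
    show "Max A < 1" using finA less by (subst Max_less_iff) (auto simp: A_def)
    fix b and \<eta> :: "'p mod_ring \<Rightarrow> complex"
    assume \<eta>: "character \<eta>" "\<eta> \<noteq> (\<lambda>_. 1)"
    have "site_law \<mu> ?S 0 b = site_law \<mu> ?S 0 (restrict b ?S)"
      by (rule site_law_cong) auto
    moreover have "?h (restrict b ?S) \<eta> \<in> A"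
      using \<eta> unfolding A_def by (intro insertI2 image_eqI[of _ _ "(restrict b ?S, \<eta>)"]) auto
    ultimately show "?h b \<eta> \<le> Max A"
      using finA by (simp add: Max_ge)
  qed
qed

section \<open>Separated sets\<close>

text \<open>
  Take \<open>J\<close> maximal. Each further site of \<open>K\<close> is then a neighbour of a site in \<open>J\<close>, so the
  translates \<open>j + ({0} \<union> B)\<close> with \<open>j \<in> J\<close> cover \<open>K\<close>. The symmetry of \<open>B\<close> enters because
  maximality yields \<open>k - j \<in> B\<close> or \<open>j - k \<in> B\<close>.
\<close>

lemma separated_subset:
  fixes K B :: "'m::ab_group_add set"
  assumes "finite K" "finite B" "uminus ` B = B"
  obtains J where "J \<subseteq> K" "\<And>i j. i \<in> J \<Longrightarrow> j \<in> J \<Longrightarrow> i \<noteq> j \<Longrightarrow> i - j \<notin> B"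
    "card K \<le> card J * Suc (card B)"
proof -
  let ?sep = "\<lambda>J. J \<subseteq> K \<and> (\<forall>i\<in>J. \<forall>j\<in>J. i \<noteq> j \<longrightarrow> i - j \<notin> B)"
  define F where "F = {J. ?sep J}"
  have "F \<subseteq> Pow K" by (auto simp: F_def)
  then have "finite F" using assms(1) by (simp add: finite_subset)
  moreover have "{} \<in> F" by (simp add: F_def)
  ultimately obtain J where max: "J \<in> F" "\<forall>J'\<in>F. J \<subseteq> J' \<longrightarrow> J = J'"
    using finite_has_maximal[of F] by blast
  have J: "?sep J"
    using max(1) by (simp add: F_def)
  have Jmax: "J = J'" if "?sep J'" "J \<subseteq> J'" for J'
    using max(2) that by (simp add: F_def)
  have "finite J" using J assms(1) finite_subset by blast
  have neg: "- x \<in> B" if "x \<in> B" for x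
    using assms(3) that by blast
  have "K \<subseteq> (\<lambda>(j, b). j + b) ` (J \<times> insert 0 B)"
  proof
    fix k assume k: "k \<in> K"
    show "k \<in> (\<lambda>(j, b). j + b) ` (J \<times> insert 0 B)"
    proof (cases "k \<in> J")
      case True
      then show ?thesis by (intro image_eqI[of _ _ "(k, 0)"]) auto
    next
      case False
      then have "\<not> ?sep (insert k J)"
        using Jmax[of "insert k J"] by blast
      then obtain j where "j \<in> J" "k - j \<in> B \<or> j - k \<in> B"
        using J k by blast
      then have "j \<in> J" "k - j \<in> B"
        using neg[of "j - k"] by auto
      then show ?thesis by (intro image_eqI[of _ _ "(j, k - j)"]) auto
    qed
  qed
  then have "card K \<le> card (J \<times> insert 0 B)"
    using \<open>finite J\<close> assms(2) by (intro surj_card_le) auto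
  also have "\<dots> \<le> card J * Suc (card B)"
    using assms(2) by (simp add: card_cartesian_product card_insert_if)
  finally show thesis using that[of J] J by blast
qed

section \<open>Harmonic mixing\<close>

theorem theorem1p3:
  fixes \<mu> :: "(int ^ 'd \<Rightarrow> 'p::finite mod_ring) measure"
    and B :: "(int ^ 'd) set"
  assumes "prime CARD('p)"
    and "finite B" and "uminus ` B = B"
    and "prob_space \<mu>" and "sets \<mu> = sets borel"
    and "shift_invariant \<mu>"
    and "markov_random_field B \<mu>"
    and "locally_free B \<mu>"
  shows "harmonically_mixing \<mu>"
  unfolding harmonically_mixing_def
proof (intro allI impI)
  fix \<epsilon> :: real assume "\<epsilon> > 0"
  obtain \<rho> where \<rho>: "0 \<le> \<rho>" "\<rho> < 1"
    "\<And>b \<eta>. character \<eta> \<Longrightarrow> \<eta> \<noteq> (\<lambda>_. 1) \<Longrightarrow>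
      norm (\<Sum>a\<in>UNIV. site_law \<mu> (B - {0}) 0 b a *\<^sub>R \<eta> a) \<le> \<rho>"
    using locally_free_contraction[OF assms(1,2,4,5,8)] by metis
  obtain n where n: "\<rho> ^ n < \<epsilon>"
    using real_arch_pow_inv[OF \<open>\<epsilon> > 0\<close> \<rho>(2)] by blast
  have "norm (LINT c|\<mu>. \<psi> c) < \<epsilon>"
    if \<psi>: "character \<psi>" "char_rank \<psi> > n * Suc (card B)" for \<psi>
  proof -
    obtain K \<xi> where K: "finite K" "card K = char_rank \<psi>"
      "\<And>k. k \<in> K \<Longrightarrow> character (\<xi> k) \<and> \<xi> k \<noteq> (\<lambda>_. 1)"
      "\<And>c. \<psi> c = (\<Prod>k\<in>K. \<xi> k (c k))"
      using character_rank_factorization[OF \<psi>(1)] by metis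
    obtain J where J: "J \<subseteq> K" "\<And>i j. i \<in> J \<Longrightarrow> j \<in> J \<Longrightarrow> i \<noteq> j \<Longrightarrow> i - j \<notin> B"
      "card K \<le> card J * Suc (card B)"
      using separated_subset[OF K(1) assms(2,3)] by metis
    have "n * Suc (card B) < card J * Suc (card B)"
      using J(3) K(2) \<psi>(2) by linarith
    then have nJ: "n \<le> card J" by (simp only: mult_less_cancel2 less_imp_le)
    let ?H = "\<lambda>c. \<Prod>k\<in>K - J. \<xi> k (c k)"
    have "norm (LINT c|\<mu>. (\<Prod>j\<in>J. \<xi> j (c j)) * ?H c) \<le> \<rho> ^ card J * 1"
    proof (rule integral_separated_bound[OF assms(4,5,7,2) _ J(2) _ \<rho>(1), of _ _ "K - J"])
      show "norm (\<Sum>a\<in>UNIV. site_law \<mu> ((+) j ` (B - {0})) j b a *\<^sub>R \<xi> j a) \<le> \<rho>"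
        if "j \<in> J" for j b
        using that J(1) K(3)[of j] \<rho>(3) site_law_shift[OF assms(5,6), of "B - {0}" j b] assms(2)
        by auto
      show "depends_on (K - J) ?H"
        by (auto simp: depends_on_def intro!: prod.cong)
      show "norm (?H c) \<le> 1" for c
        using K(3) by (simp add: prod_norm[symmetric] character_def)
    qed (use J(1) K(1) finite_subset in auto)
    moreover have "(\<Prod>j\<in>J. \<xi> j (c j)) * ?H c = \<psi> c" for c
      unfolding K(4) by (subst prod.subset_diff[OF J(1) K(1)]) (simp add: mult.commute)
    moreover have "\<rho> ^ card J \<le> \<rho> ^ n"
      using nJ \<rho>(1,2) by (intro power_decreasing) auto
    ultimately show ?thesis using n by simp
  qed
  then show "\<exists>R. \<forall>\<psi>. character \<psi> \<and> char_rank \<psi> > R \<longrightarrow> norm (LINT c|\<mu>. \<psi> c) < \<epsilon>"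
    by blast
qed

end
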